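(* For every digraph $D$ of order $n$ and every integer $k$ with $1\le k\le n-1$, $g(D)=g(F_k(D))$ and $c(D)\le c(F_k(D))$.
   Context: A digraph $D$ has a finite vertex set $V(D)$ and a set $A(D)$ of arcs, which are ordered pairs of distinct vertices (both $(x,y)$ and $(y,x)$ may be arcs). For a digraph $D$ of order $n$ and $1 \le k \le n-1$, the $k$-token digraph $F_k(D)$ has as vertices all $k$-subsets of $V(D)$, and $(A,B)$ is an arc of $F_k(D)$ whenever $A\setminus B=\{a\}$, $B\setminus A=\{b\}$ and $(a,b)\in A(D)$. An oriented cycle is a directed cycle without repeated vertices (other than the first and last); length $2$ (a digon) is allowed. The oriented girth $g(D)$ is the length of a shortest oriented cycle in $D$, and the oriented circumference $c(D)$ is the length of a longest oriented cycle in $D$. For a digraph without oriented cycles, use the convention $g=\infty$ and $c=0$. *)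

theory Defs
  imports Graph_Theory.Pair_Digraph "HOL-Library.Extended_Nat"
begin

text \<open>
  A digraph with finite vertex set and arcs that are ordered pairs of distinct vertices is a
  \<^locale>\<open>pair_digraph\<close>. The library predicate \<^const>\<open>pre_digraph.cycle\<close> describes oriented cycles
  as nonempty lists of arcs without repeated vertices (other than first and last); it admits
  digons, and the list length is the number of arcs.
\<close>

definition token_digraph :: "nat \<Rightarrow> 'a pair_pre_digraph \<Rightarrow> 'a set pair_pre_digraph" where
  "token_digraph k D =
    \<lparr> pverts = {A. A \<subseteq> pverts D \<and> card A = k},
      parcs = {(A, B). A \<subseteq> pverts D \<and> card A = k \<and> B \<subseteq> pverts D \<and> card B = k \<and>
                 (\<exists>a b. A - B = {a} \<and> B - A = {b} \<and> (a, b) \<in> parcs D)} \<rparr>"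

text \<open>
  In \<^typ>\<open>enat\<close> the infimum over the empty set is \<open>\<infinity>\<close> and the supremum over the empty set
  is \<open>0\<close>, which are exactly the conventions for digraphs without oriented cycles. A nonempty
  infimum is attained; in a finite digraph so is the supremum, as cycle lengths are bounded by
  the number of vertices.
\<close>

definition oriented_girth :: "('a, 'b) pre_digraph \<Rightarrow> enat" where
  "oriented_girth G = (INF p \<in> {p. pre_digraph.cycle G p}. enat (length p))"

definition oriented_circumference :: "('a, 'b) pre_digraph \<Rightarrow> enat" where
  "oriented_circumference G = (SUP p \<in> {p. pre_digraph.cycle G p}. enat (length p))"

lemma pair_digraph_token_digraph:
  assumes "pair_digraph D"
  shows "pair_digraph (token_digraph k D)"
proof -
  interpret pair_digraph D by fact
  have fin: "finite (pverts (token_digraph k D))"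
    by (rule finite_subset[of _ "Pow (pverts D)"])
      (auto simp: token_digraph_def pair_finite_verts)
  have sub: "parcs (token_digraph k D) \<subseteq>
      pverts (token_digraph k D) \<times> pverts (token_digraph k D)"
    by (auto simp: token_digraph_def)
  show ?thesis
  proof (unfold_locales)
    fix e assume e: "e \<in> parcs (token_digraph k D)"
    show "fst e \<in> pverts (token_digraph k D)" "snd e \<in> pverts (token_digraph k D)"
      using e sub by (auto simp: mem_Times_iff dest: subsetD)
    obtain A B where AB: "e = (A, B)" by (cases e)
    with e obtain a where "A - B = {a}"
      by (auto simp: token_digraph_def)
    then show "fst e \<noteq> snd e"
      using AB by auto
  next
    show "finite (parcs (token_digraph k D))"
      by (rule finite_subset[OF sub]) (intro finite_cartesian_product fin)
  qed (rule fin)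
qed

end

theory Submission
  imports Defs
begin

text \<open>
  Write \<open>F\<close> for the \<open>k\<close>-token digraph of \<open>D\<close>. A vertex of \<open>F\<close> is a placement of \<open>k\<close>
  indistinguishable tokens on the vertices of \<open>D\<close>, at most one on each, and an arc of \<open>F\<close> slides
  one token along an arc of \<open>D\<close> to a free vertex. Two facts give the theorem.

  Every cycle of \<open>D\<close> of length \<open>l\<close> yields a cycle of \<open>F\<close> of the same length
  (\<open>cycle_imp_token_cycle\<close>). Put \<open>j\<close> tokens with \<open>1 \<le> j < l\<close> on the cycle and park the others off
  it; such a \<open>j\<close> exists because \<open>1 \<le> k < n\<close>. Let each of the \<open>j\<close> tokens advance exactly to the
  starting position of the next one. Together they travel once round the cycle, so the tokens
  occupy the initial set again after exactly \<open>l\<close> slides, and no set occurs twice before that.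
  Hence the circumference does not decrease and the girth does not increase.

  Every cycle of \<open>F\<close> of length \<open>m\<close> yields a cycle of \<open>D\<close> of length at most \<open>m\<close>
  (\<open>token_cycle_imp_cycle\<close>). Let \<open>H\<close> be the set of vertices of \<open>D\<close> from which some token slides
  during the cycle, so that \<open>H\<close> has at most \<open>m\<close> elements. A vertex that receives a token must give
  it up again before the tokens return to their initial placement; so each slide from \<open>H\<close> ends in
  \<open>H\<close>, and following slides inside the finite set \<open>H\<close> closes a cycle with at most \<open>m\<close> vertices.
  Hence the girth does not decrease.
\<close>

section \<open>Cycles as cyclic vertex sequences\<close>

text \<open>
  The vertex at index \<open>m\<close> repeats the one at index \<open>0\<close>, so that all \<open>m\<close> arcs, including the closing
  one, join consecutive indices and no arithmetic modulo \<open>m\<close> is needed.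
\<close>

definition cyclic_seq :: "'v rel \<Rightarrow> nat \<Rightarrow> (nat \<Rightarrow> 'v) \<Rightarrow> bool" where
  "cyclic_seq A m w \<longleftrightarrow>
    0 < m \<and> inj_on w {..<m} \<and> w m = w 0 \<and> (\<forall>i<m. (w i, w (Suc i)) \<in> A)"

text \<open>
  The vertices of a closed sequence may be listed without its last entry or without its first one;
  the predicate \<^const>\<open>pre_digraph.cycle\<close> drops the first.
\<close>

lemma inj_on_closed_seq_shift:
  fixes w :: "nat \<Rightarrow> 'v"
  assumes "w m = w 0"
  shows "inj_on w {..<m} \<longleftrightarrow> inj_on w {1..m}"
proof (cases "m = 0")
  case False
  then have "{..<m} = insert 0 {1..<m}" "{1..m} = insert m {1..<m}" by auto
  then show ?thesis using assms by (simp add: inj_on_insert)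
qed simp

lemma pcas_nth:
  assumes "pcas u p v"
  shows "pawalk_verts u p ! 0 = u" "pawalk_verts u p ! length p = v"
    and "i < length p \<Longrightarrow> p ! i = (pawalk_verts u p ! i, pawalk_verts u p ! Suc i)"
proof -
  have "pawalk_verts u p ! 0 = u \<and> pawalk_verts u p ! length p = v \<and>
    (\<forall>i<length p. p ! i = (pawalk_verts u p ! i, pawalk_verts u p ! Suc i))"
    using assms
    by (induction p arbitrary: u) (auto simp: less_Suc_eq_0_disj prod_eq_iff)
  then show "pawalk_verts u p ! 0 = u" "pawalk_verts u p ! length p = v"
    and "i < length p \<Longrightarrow> p ! i = (pawalk_verts u p ! i, pawalk_verts u p ! Suc i)"
    by auto
qed

lemma pcas_map_upt:
  "i \<le> j \<Longrightarrow> pcas (w i) (map (\<lambda>l. (w l, w (Suc l))) [i..<j]) (w j)"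
proof (induction "j - i" arbitrary: i)
  case (Suc d)
  then have "i < j" "d = j - Suc i" by auto
  with Suc show ?case by (simp add: upt_rec)
qed simp

lemma pawalk_verts_map_upt:
  "pawalk_verts (w 0) (map (\<lambda>l. (w l, w (Suc l))) [0..<m]) = map w [0..<Suc m]"
proof -
  have "i \<le> j \<Longrightarrow>
    pawalk_verts (w i) (map (\<lambda>l. (w l, w (Suc l))) [i..<j]) = map w [i..<Suc j]" for i j
  proof (induction "j - i" arbitrary: i)
    case (Suc d)
    then have ij: "i < j" "d = j - Suc i" by auto
    with Suc.hyps(1)[OF ij(2)] show ?case by (simp add: upt_conv_Cons del: upt_Suc)
  qed simp
  then show ?thesis by blast
qed

lemma (in pair_wf_digraph) ex_cycle_iff_cyclic_seq:
  "(\<exists>p. cycle p \<and> length p = m) \<longleftrightarrow> (\<exists>w. cyclic_seq (parcs G) m w)"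
proof
  assume "\<exists>p. cycle p \<and> length p = m"
  then obtain p u where p: "awalk u p u" "distinct (tl (pawalk_verts u p))" "p \<noteq> []"
    and m: "length p = m" by (auto simp: cycle_def)
  define w where "w i = pawalk_verts u p ! i" for i
  from p have cas: "pcas u p u" and arcs: "set p \<subseteq> parcs G" by (auto simp: awalk_def)
  note nth = pcas_nth[OF cas, folded w_def, unfolded m]
  have len: "length (pawalk_verts u p) = Suc m"
    using length_awalk_verts[of u p] m by simp
  have "inj_on w {1..m}"
  proof (rule inj_onI)
    fix i j assume "i \<in> {1..m}" "j \<in> {1..m}" "w i = w j"
    then show "i = j"
      using nth_eq_iff_index_eq[OF p(2), of "i - 1" "j - 1"] len
      by (simp add: w_def nth_tl) linarith
  qed
  then have "inj_on w {..<m}" using nth inj_on_closed_seq_shift by metis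
  moreover have "(w i, w (Suc i)) \<in> parcs G" if "i < m" for i
    using nth(3)[OF that] arcs that m nth_mem by (metis subsetD)
  ultimately have "cyclic_seq (parcs G) m w"
    using p(3) m nth by (auto simp: cyclic_seq_def)
  then show "\<exists>w. cyclic_seq (parcs G) m w" by blast
next
  assume "\<exists>w. cyclic_seq (parcs G) m w"
  then obtain w where w: "0 < m" "inj_on w {..<m}" "w m = w 0"
    and arc: "\<And>i. i < m \<Longrightarrow> (w i, w (Suc i)) \<in> parcs G" by (auto simp: cyclic_seq_def)
  define p where "p = map (\<lambda>l. (w l, w (Suc l))) [0..<m]"
  have "pcas (w 0) p (w 0)" using pcas_map_upt[of 0 m w] w(3) by (simp add: p_def)
  moreover have "set p \<subseteq> parcs G" using arc by (auto simp: p_def)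
  moreover have "w 0 \<in> pverts G" using arc[of 0] w(1) in_arcsD1 by auto
  ultimately have "awalk (w 0) p (w 0)" by (simp add: awalk_def)
  moreover have "tl (pawalk_verts (w 0) p) = map w [1..<Suc m]"
    by (simp add: p_def pawalk_verts_map_upt map_tl[symmetric] del: upt_Suc)
  then have "distinct (tl (pawalk_verts (w 0) p))"
    using w inj_on_closed_seq_shift[of w m]
    by (simp add: distinct_map atLeastLessThanSuc_atLeastAtMost del: upt_Suc)
  ultimately have "cycle p" "length p = m" using w(1) by (auto simp: cycle_def p_def)
  then show "\<exists>p. cycle p \<and> length p = m" by blast
qed

lemma oriented_girth_with_proj:
  assumes "pair_digraph G"
  shows "oriented_girth (with_proj G) = (INF m \<in> {m. \<exists>w. cyclic_seq (parcs G) m w}. enat m)"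
proof -
  interpret pair_digraph G by fact
  have "(enat \<circ> length) ` {p. cycle p} = enat ` {m. \<exists>w. cyclic_seq (parcs G) m w}"
    by (auto simp: ex_cycle_iff_cyclic_seq[symmetric])
  then show ?thesis by (simp add: oriented_girth_def comp_def)
qed

lemma oriented_circumference_with_proj:
  assumes "pair_digraph G"
  shows "oriented_circumference (with_proj G) =
    (SUP m \<in> {m. \<exists>w. cyclic_seq (parcs G) m w}. enat m)"
proof -
  interpret pair_digraph G by fact
  have "(enat \<circ> length) ` {p. cycle p} = enat ` {m. \<exists>w. cyclic_seq (parcs G) m w}"
    by (auto simp: ex_cycle_iff_cyclic_seq[symmetric])
  then show ?thesis by (simp add: oriented_circumference_def comp_def)
qed

section \<open>Cycles of the token digraph give cycles of the digraph\<close>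

text \<open>
  Iterating a choice of successors inside \<open>H\<close> gives an infinite walk, which must revisit a vertex.
  A revisit with the smallest possible gap bounds a stretch of the walk without repetitions.
\<close>

lemma finite_successor_closed_imp_cyclic_seq:
  assumes fin: "finite H" and ne: "H \<noteq> {}"
    and succ: "\<And>x. x \<in> H \<Longrightarrow> \<exists>y\<in>H. (x, y) \<in> A"
  shows "\<exists>m w. m \<le> card H \<and> cyclic_seq A m w"
proof -
  obtain f where f: "\<And>x. x \<in> H \<Longrightarrow> f x \<in> H \<and> (x, f x) \<in> A" using succ by metis
  obtain x0 where x0: "x0 \<in> H" using ne by blast
  define x where "x i = (f ^^ i) x0" for i
  have xH: "x i \<in> H" for i by (induction i) (auto simp: x_def x0 f)
  have arc: "(x i, x (Suc i)) \<in> A" for i using f[OF xH[of i]] by (simp add: x_def)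
  define rep where "rep d \<longleftrightarrow> 0 < d \<and> (\<exists>i. x (i + d) = x i)" for d
  have "\<not> inj x" using fin xH finite_imageD[of x UNIV] finite_subset[of "range x" H] by auto
  then obtain i j where "i < j" "x i = x j" unfolding inj_def by (metis nat_neq_iff)
  then have "rep (j - i)" by (auto simp: rep_def intro!: exI[of _ i])
  define m where "m = (LEAST d. rep d)"
  have "rep m" unfolding m_def by (rule LeastI) fact
  then obtain i where i: "0 < m" "x (i + m) = x i" by (auto simp: rep_def)
  define w where "w l = x (i + l)" for l
  have inj: "inj_on w {..<m}"
  proof (rule linorder_inj_onI)
    fix a b assume ab: "a < b" "a \<in> {..<m}" "b \<in> {..<m}"
    show "w a \<noteq> w b"
    proof
      assume "w a = w b"
      then have "rep (b - a)" using ab by (auto simp: rep_def w_def intro!: exI[of _ "i + a"])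
      then have "m \<le> b - a" unfolding m_def by (rule Least_le)
      then show False using ab by auto
    qed
  qed auto
  have "cyclic_seq A m w" using i inj arc by (auto simp: cyclic_seq_def w_def)
  moreover have "m \<le> card H"
    using card_inj_on_le[OF inj _ fin] xH by (auto simp: w_def)
  ultimately show ?thesis by blast
qed

lemma token_cycle_imp_cycle:
  assumes "cyclic_seq (parcs (token_digraph k D)) m S"
  shows "\<exists>l w. l \<le> m \<and> cyclic_seq (parcs D) l w"
proof -
  from assms have m: "0 < m" and closed: "S m = S 0"
    and "\<forall>i<m. \<exists>a b. S i - S (Suc i) = {a} \<and> S (Suc i) - S i = {b} \<and> (a, b) \<in> parcs D"
    by (auto simp: cyclic_seq_def token_digraph_def)
  then obtain a b where move: "\<And>i. i < m \<Longrightarrow>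
      S i - S (Suc i) = {a i} \<and> S (Suc i) - S i = {b i} \<and> (a i, b i) \<in> parcs D"
    by metis
  \<comment> \<open>A vertex that is never vacated stays occupied from the slide that fills it to the end of
    the cycle, hence also from the beginning up to that slide, where it should be free.\<close>
  have b_leaves: "b i \<in> a ` {..<m}" if i: "i < m" for i
  proof (rule ccontr)
    assume no: "b i \<notin> a ` {..<m}"
    have stay: "b i \<in> S (Suc j)" if "j < m" "b i \<in> S j" for j
      using move[OF that(1)] that no by blast
    have mono: "b i \<in> S j'" if "b i \<in> S j" "j \<le> j'" "j' \<le> m" for j j'
      using that(2,1,3) by (induction rule: dec_induct) (auto intro: stay)
    have "b i \<in> S (Suc i)" "b i \<notin> S i" using move[OF i] by auto
    then show False using mono[of "Suc i" m] mono[of 0 i] closed i by auto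
  qed
  have "\<exists>y\<in>a ` {..<m}. (x, y) \<in> parcs D" if "x \<in> a ` {..<m}" for x
    using that move b_leaves by blast
  then obtain l w where "l \<le> card (a ` {..<m})" "cyclic_seq (parcs D) l w"
    using finite_successor_closed_imp_cyclic_seq[of "a ` {..<m}" "parcs D"] m by auto
  moreover have "card (a ` {..<m}) \<le> m" using card_image_le[of "{..<m}" a] by simp
  ultimately show ?thesis by (meson le_trans)
qed

section \<open>Cycles of the digraph give token cycles of the same length\<close>

text \<open>
  The schedule of \<open>j\<close> tokens on a cycle with vertices \<open>0, \<dots>, l - 1\<close>, where \<open>l\<close> is identified with
  \<open>0\<close>. The tokens start on \<open>0, \<dots>, j - 1\<close>. In the first \<open>j\<close> slides each of them advances by one,
  the front token first, which amounts to a hole moving from \<open>j\<close> back to \<open>0\<close>. In the remaining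
  \<open>l - j\<close> slides the front token runs from \<open>j\<close> to \<open>l\<close>; it takes the starting position \<open>0\<close> of the
  rear token, and \<open>0, \<dots>, j - 1\<close> are occupied again.
\<close>

definition token_positions :: "nat \<Rightarrow> nat \<Rightarrow> nat set" where
  "token_positions j t = (if t \<le> j then {0..j} - {j - t} else insert t {1..<j})"

lemma card_token_positions: "1 \<le> j \<Longrightarrow> card (token_positions j t) = j"
  by (auto simp: token_positions_def)

text \<open>
  On the positions in use before and after any one slide the identification of \<open>l\<close> with \<open>0\<close> is
  harmless: one of the two windows below contains both sets.
\<close>

lemma token_positions_subset:
  assumes "1 \<le> j" "j < l"
  shows "t < l \<Longrightarrow> token_positions j t \<subseteq> {..<l}"
    and "j \<le> t \<Longrightarrow> t \<le> l \<Longrightarrow> token_positions j t \<subseteq> {1..l}"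
  using assms by (auto simp: token_positions_def)

lemma inj_token_positions:
  assumes "1 \<le> j"
  shows "inj (token_positions j)"
proof (rule linorder_injI)
  fix s t :: nat assume st: "s < t"
  show "token_positions j s \<noteq> token_positions j t"
  proof (cases "t \<le> j")
    case True
    with st have "j - s \<in> token_positions j t - token_positions j s"
      by (auto simp: token_positions_def)
    then show ?thesis by blast
  next
    case False
    with st have "t \<in> token_positions j t - token_positions j s"
      by (auto simp: token_positions_def)
    then show ?thesis by blast
  qed
qed

text \<open>
  In the first phase the hole at \<open>j - t\<close> is filled by the token just behind it, in the second phase
  the front token is at \<open>t\<close>.
\<close>

lemma token_positions_step:
  assumes "1 \<le> j"
  defines "a \<equiv> \<lambda>t. if t < j then j - 1 - t else t"
  shows "token_positions j t - token_positions j (Suc t) = {a t}"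
    and "token_positions j (Suc t) - token_positions j t = {Suc (a t)}"
  using assms(1) unfolding a_def token_positions_def
  by (cases "t < j"; cases "t = j"; auto)+

text \<open>
  The schedule is run on the given cycle while \<open>k - j\<close> tokens stay parked on a set \<open>T\<close> off the
  cycle. The bound \<open>k < card (pverts D)\<close> is what leaves a free vertex on the cycle even when all
  vertices off the cycle are occupied.
\<close>

lemma cycle_imp_token_cycle:
  assumes D: "pair_digraph D" and cyc: "cyclic_seq (parcs D) l v"
    and k: "1 \<le> k" "k < card (pverts D)"
  shows "\<exists>W. cyclic_seq (parcs (token_digraph k D)) l W"
proof -
  interpret pair_digraph D by fact
  from cyc have l: "0 < l" and inj: "inj_on v {..<l}" and closed: "v l = v 0"
    and arc: "\<And>i. i < l \<Longrightarrow> (v i, v (Suc i)) \<in> parcs D"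
    by (auto simp: cyclic_seq_def)
  have inj': "inj_on v {1..l}" using inj inj_on_closed_seq_shift[of v l, OF closed] by simp
  have "l \<noteq> 1" using arc[of 0] closed pair_no_loops by fastforce
  with l have l2: "2 \<le> l" by simp
  have vV: "v i \<in> pverts D" if "i \<le> l" for i
    using arc[of i] in_arcsD1 that closed arc[of 0] l by (cases "i = l") auto
  define R where "R = pverts D - v ` {..<l}"
  have sub: "v ` {..<l} \<subseteq> pverts D" using vV by auto
  have cR: "card R = card (pverts D) - l"
    using card_Diff_subset[OF _ sub] card_image[OF inj] by (simp add: R_def)
  have lV: "l \<le> card (pverts D)"
    using card_mono[OF pair_finite_verts sub] card_image[OF inj] by simp
  \<comment> \<open>Park as many tokens as possible off the cycle, but keep at least one on it.\<close>
  define j where "j = max 1 (k - card R)"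
  have j: "1 \<le> j" "j < l" "j \<le> k" "k - j \<le> card R"
    using k l2 lV cR by (auto simp: j_def)
  obtain T where T: "T \<subseteq> R" "card T = k - j" "finite T"
    using obtain_subset_with_card_n[OF j(4)] by metis
  define W where "W t = v ` token_positions j t \<union> T" for t
  have disj: "v i \<notin> T" if "i \<le> l" for i
    using that T(1) closed l by (cases "i = l") (auto simp: R_def)
  have injX: "inj_on v (token_positions j t \<union> token_positions j (Suc t))" if "t < l" for t
  proof (cases "t < j")
    case True
    with j token_positions_subset(1)[OF j(1,2), of t] token_positions_subset(1)[OF j(1,2), of "Suc t"]
    show ?thesis by (intro inj_on_subset[OF inj]) auto
  next
    case False
    with that token_positions_subset(2)[OF j(1,2), of t]
      token_positions_subset(2)[OF j(1,2), of "Suc t"]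
    show ?thesis by (intro inj_on_subset[OF inj']) auto
  qed
  have le_l: "token_positions j t \<subseteq> {..l}" if "t \<le> l" for t
    using that j by (auto simp: token_positions_def)
  have vert: "W t \<subseteq> pverts D \<and> card (W t) = k" if "t < l" for t
  proof -
    have "card (v ` token_positions j t) = j"
      using card_image[OF inj_on_subset[OF injX[OF that]], of "token_positions j t"]
        card_token_positions[OF j(1)] by simp
    moreover have "finite (token_positions j t)" by (auto simp: token_positions_def)
    moreover have "v ` token_positions j t \<inter> T = {}" using le_l[of t] that disj by fastforce
    ultimately have "card (W t) = k" using T j by (simp add: W_def card_Un_disjoint)
    moreover have "W t \<subseteq> pverts D" using le_l[of t] that vV T by (auto simp: W_def R_def)
    ultimately show ?thesis by blast
  qed
  have tp0: "token_positions j l = insert l {1..<j}" "token_positions j 0 = insert 0 {1..<j}"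
    using j by (auto simp: token_positions_def)
  have W_closed: "W l = W 0" by (simp add: W_def tp0 closed)
  have W_arc: "(W t, W (Suc t)) \<in> parcs (token_digraph k D)" if t: "t < l" for t
  proof -
    define a where "a = (if t < j then j - 1 - t else t)"
    note step = token_positions_step[OF j(1), of t, folded a_def]
    let ?X = "token_positions j t" and ?Y = "token_positions j (Suc t)"
    have al: "a < l" using t j by (auto simp: a_def)
    have "v ` ?X - v ` ?Y = {v a}" "v ` ?Y - v ` ?X = {v (Suc a)}"
      using inj_on_image_set_diff[OF injX[OF t], of ?X ?Y]
        inj_on_image_set_diff[OF injX[OF t], of ?Y ?X] step by auto
    then have "W t - W (Suc t) = {v a}" "W (Suc t) - W t = {v (Suc a)}"
      using disj[of a] disj[of "Suc a"] al by (auto simp: W_def)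
    moreover have "W (Suc t) \<subseteq> pverts D \<and> card (W (Suc t)) = k"
      using vert[of "Suc t"] vert[of 0] W_closed t l by (cases "Suc t = l") auto
    ultimately show ?thesis using vert[OF t] arc[OF al] by (auto simp: token_digraph_def)
  qed
  have "inj_on W {..<l}"
  proof (rule inj_onI)
    fix s t assume st: "s \<in> {..<l}" "t \<in> {..<l}" "W s = W t"
    have "v ` token_positions j i = W i - T" if "i < l" for i
      using le_l[of i] disj that by (fastforce simp: W_def)
    with st have "v ` token_positions j s = v ` token_positions j t" by simp
    then have "token_positions j s = token_positions j t"
      using inj_on_image_eq_iff[OF inj] token_positions_subset(1)[OF j(1,2)] st by auto
    then show "s = t" using inj_token_positions[OF j(1)] by (auto dest: injD)
  qed
  then have "cyclic_seq (parcs (token_digraph k D)) l W"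
    using l W_closed W_arc by (auto simp: cyclic_seq_def)
  then show ?thesis by blast
qed

section \<open>Girth and circumference\<close>

theorem theorem6p1:
  fixes D :: "'a pair_pre_digraph" and n k :: nat
  assumes "pair_digraph D"
    and "card (pverts D) = n"
    and "1 \<le> k" and "k \<le> n - 1"
  shows "oriented_girth (with_proj D) = oriented_girth (with_proj (token_digraph k D))
    \<and> oriented_circumference (with_proj D)
        \<le> oriented_circumference (with_proj (token_digraph k D))"
proof -
  let ?F = "token_digraph k D"
  note F = pair_digraph_token_digraph[OF assms(1), of k]
  have lift: "\<exists>W. cyclic_seq (parcs ?F) l W" if "cyclic_seq (parcs D) l v" for l v
    using cycle_imp_token_cycle[OF assms(1) that] assms by auto
  have "oriented_girth (with_proj D) = oriented_girth (with_proj ?F)"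
    unfolding oriented_girth_with_proj[OF assms(1)] oriented_girth_with_proj[OF F]
  proof (rule antisym)
    show "(INF m \<in> {m. \<exists>w. cyclic_seq (parcs D) m w}. enat m)
        \<le> (INF m \<in> {m. \<exists>w. cyclic_seq (parcs ?F) m w}. enat m)"
      using token_cycle_imp_cycle by (fastforce intro!: INF_mono)
    show "(INF m \<in> {m. \<exists>w. cyclic_seq (parcs ?F) m w}. enat m)
        \<le> (INF m \<in> {m. \<exists>w. cyclic_seq (parcs D) m w}. enat m)"
      using lift by (intro INF_superset_mono) auto
  qed
  moreover have "oriented_circumference (with_proj D) \<le> oriented_circumference (with_proj ?F)"
    unfolding oriented_circumference_with_proj[OF assms(1)] oriented_circumference_with_proj[OF F]
    using lift by (intro SUP_subset_mono) auto
  ultimately show ?thesis ..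
qed

end
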